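(* Let $G$ be a group, let $X$ be an infinite transitive $G$-space, and let $J\neq\{\varnothing\}$ be a translation invariant ideal in $\mathcal{P}_X$. A subset $A$ of $X$ is $J$-thin if and only if $|\bigtriangleup_p(A)|\le 1$ for each $p\in\check{J}$.
   Context: $\mathcal{P}_X$ is the Boolean algebra of all subsets of $X$, and $[G]^{<\omega}$ is the family of all finite subsets of $G$. An ideal $J$ in $\mathcal{P}_X$ is a family of subsets of $X$ with $X\notin J$ such that $A,B\in J$ and $C\subseteq A$ imply $A\cup B\in J$ and $C\in J$. $J$ is translation invariant if $gA=\{ga:a\in A\}\in J$ for all $g\in G$, $A\in J$. A subset $A\subseteq X$ is $J$-thin if, for every $F\in[G]^{<\omega}$, there exists $I\in J$ such that $|Fa\cap A|\le 1$ for each $a\in A\setminus I$, where $Fa=\{ga:g\in F\}$. $\beta X$ is the Stone–Čech compactification of the discrete space $X$, i.e. the space of ultrafilters on $X$, with points of $X$ identified with principal ultrafilters; $X^*=\beta X\setminus X$. For $g\in G$ and $p\in\beta X$, $gp=\{gP: P\in p\}$. For $A\subseteq X$ and $p\in X^*$, the $p$-companion of $A$ is $\bigtriangleup_p(A)=\{gp: g\in G, A\in gp\}$. Finally, $\check{J}=\{p\in X^*: X\setminus I\in p\text{ for each }I\in J\}$. *)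

theory Defs
  imports "HOL-Algebra.Group_Action"
begin

text \<open>
  The \<open>G\<close>-space \<open>X\<close> is an action \<open>\<phi>\<close> of the group \<open>G\<close> on the set \<open>X\<close> in the sense of
  \<^locale>\<open>group_action\<close>, so \<open>ga\<close> is \<open>\<phi> g a\<close> and \<open>gA\<close> is the image \<open>\<phi> g ` A\<close>.
\<close>

text \<open>Nonemptiness is part of the usual notion of an ideal of a Boolean algebra;
  without it the empty family would qualify.\<close>

definition set_ideal :: "'x set \<Rightarrow> 'x set set \<Rightarrow> bool" where
  "set_ideal X J \<longleftrightarrow> J \<subseteq> Pow X \<and> J \<noteq> {} \<and> X \<notin> J \<and>
     (\<forall>A\<in>J. \<forall>B\<in>J. \<forall>C. C \<subseteq> A \<longrightarrow> A \<union> B \<in> J \<and> C \<in> J)"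

definition translation_invariant ::
  "('g, 'm) monoid_scheme \<Rightarrow> ('g \<Rightarrow> 'x \<Rightarrow> 'x) \<Rightarrow> 'x set set \<Rightarrow> bool" where
  "translation_invariant G \<phi> J \<longleftrightarrow> (\<forall>g\<in>carrier G. \<forall>A\<in>J. \<phi> g ` A \<in> J)"

definition thin ::
  "('g, 'm) monoid_scheme \<Rightarrow> ('g \<Rightarrow> 'x \<Rightarrow> 'x) \<Rightarrow> 'x set set \<Rightarrow> 'x set \<Rightarrow> bool" where
  "thin G \<phi> J A \<longleftrightarrow>
     (\<forall>F. finite F \<and> F \<subseteq> carrier G \<longrightarrow>
        (\<exists>I\<in>J. \<forall>a\<in>A - I. card ((\<lambda>g. \<phi> g a) ` F \<inter> A) \<le> 1))"

definition ultrafilter_on :: "'x set \<Rightarrow> 'x set set \<Rightarrow> bool" where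
  "ultrafilter_on X p \<longleftrightarrow> p \<subseteq> Pow X \<and> X \<in> p \<and> {} \<notin> p \<and>
     (\<forall>P\<in>p. \<forall>Q\<in>p. P \<inter> Q \<in> p) \<and>
     (\<forall>P\<in>p. \<forall>Q. P \<subseteq> Q \<and> Q \<subseteq> X \<longrightarrow> Q \<in> p) \<and>
     (\<forall>P. P \<subseteq> X \<longrightarrow> P \<in> p \<or> X - P \<in> p)"

definition principal_ultrafilter :: "'x set \<Rightarrow> 'x \<Rightarrow> 'x set set" where
  "principal_ultrafilter X x = {P. P \<subseteq> X \<and> x \<in> P}"

text \<open>The points of \<open>\<beta>X\<close>; its topology plays no role here.\<close>

definition stone_cech :: "'x set \<Rightarrow> 'x set set set" where
  "stone_cech X = {p. ultrafilter_on X p}"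

definition stone_cech_remainder :: "'x set \<Rightarrow> 'x set set set" where
  "stone_cech_remainder X = stone_cech X - principal_ultrafilter X ` X"

definition translate_ultrafilter ::
  "('g \<Rightarrow> 'x \<Rightarrow> 'x) \<Rightarrow> 'g \<Rightarrow> 'x set set \<Rightarrow> 'x set set" where
  "translate_ultrafilter \<phi> g p = {\<phi> g ` P | P. P \<in> p}"

definition companion ::
  "('g, 'm) monoid_scheme \<Rightarrow> ('g \<Rightarrow> 'x \<Rightarrow> 'x) \<Rightarrow> 'x set set \<Rightarrow> 'x set \<Rightarrow> 'x set set set" where
  "companion G \<phi> p A =
     {translate_ultrafilter \<phi> g p | g. g \<in> carrier G \<and> A \<in> translate_ultrafilter \<phi> g p}"

definition ideal_check :: "'x set \<Rightarrow> 'x set set \<Rightarrow> 'x set set set" where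
  "ideal_check X J = {p \<in> stone_cech_remainder X. \<forall>I\<in>J. X - I \<in> p}"

end

theory Submission
  imports Defs
begin

text \<open>
  The proof compares two points \<open>g p\<close> and \<open>h p\<close> of a companion by the set of points that \<open>g\<close> and
  \<open>h\<close> move to the same place. If that set lies in \<open>p\<close>, then \<open>g p = h p\<close>
  (\<open>translate_ultrafilter_eqI\<close>).

  Let \<open>A\<close> be thin and let \<open>g p\<close>, \<open>h p\<close> both contain \<open>A\<close>, where \<open>p\<close> avoids \<open>J\<close>. For \<open>p\<close>-almost all
  \<open>x\<close> the point \<open>a = g x\<close> lies in \<open>A\<close>, outside the exceptional set that thinness gives for
  \<open>F = {\<one>, h g\<^sup>-\<^sup>1}\<close>, and \<open>h x = (h g\<^sup>-\<^sup>1) a\<close> lies in \<open>A\<close> as well; hence \<open>g x = h x\<close>, and the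
  two translates coincide.

  Let \<open>A\<close> fail to be thin, as witnessed by the finite set \<open>F\<close>. The sets
  \<open>S = {x. f x \<in> A, g x \<in> A, f x \<noteq> g x}\<close> with \<open>f, g \<in> F\<close> cannot all lie in \<open>J\<close>, since otherwise
  their finite union would serve as the exceptional set. Any \<open>p\<close> containing an \<open>S \<notin> J\<close> has \<open>A\<close> in
  both \<open>f p\<close> and \<open>g p\<close>. To be sure that these differ, one passes to a subset \<open>T\<close> of \<open>S\<close>, still
  outside \<open>J\<close>, with \<open>f T\<close> disjoint from \<open>g T\<close> (\<open>separated_subset_notin_ideal\<close>), and takes an
  ultrafilter that contains \<open>T\<close> and avoids \<open>J\<close> (\<open>ultrafilter_avoiding_ideal\<close>). Such an ultrafilter
  is not principal, because transitivity and invariance put every singleton into \<open>J\<close>.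
\<close>

section \<open>Ideals and ultrafilters\<close>

lemma set_ideal_subset: "set_ideal X J \<Longrightarrow> A \<in> J \<Longrightarrow> C \<subseteq> A \<Longrightarrow> C \<in> J"
  unfolding set_ideal_def by blast

lemma set_ideal_Un: "set_ideal X J \<Longrightarrow> A \<in> J \<Longrightarrow> B \<in> J \<Longrightarrow> A \<union> B \<in> J"
  unfolding set_ideal_def by blast

lemma set_ideal_empty: "set_ideal X J \<Longrightarrow> {} \<in> J"
  unfolding set_ideal_def by blast

lemma set_ideal_carrier: "set_ideal X J \<Longrightarrow> A \<in> J \<Longrightarrow> A \<subseteq> X"
  unfolding set_ideal_def by blast

lemma set_ideal_top: "set_ideal X J \<Longrightarrow> X \<notin> J"
  unfolding set_ideal_def by blast

lemma set_idealI:
  assumes "\<And>A. A \<in> J \<Longrightarrow> A \<subseteq> X" and "{} \<in> J" and "X \<notin> J"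
    and "\<And>A B. A \<in> J \<Longrightarrow> B \<in> J \<Longrightarrow> A \<union> B \<in> J"
    and "\<And>A C. A \<in> J \<Longrightarrow> C \<subseteq> A \<Longrightarrow> C \<in> J"
  shows "set_ideal X J"
  unfolding set_ideal_def using assms by blast

lemma set_ideal_UN:
  assumes "set_ideal X J" "finite K" "\<And>k. k \<in> K \<Longrightarrow> S k \<in> J"
  shows "(\<Union>k\<in>K. S k) \<in> J"
  using assms(2,3)
  by (induction K rule: finite_induct) (auto simp: set_ideal_empty[OF assms(1)]
      intro!: set_ideal_Un[OF assms(1)])

text \<open>
  By Zorn's lemma, since a union of a chain of proper ideals is a proper ideal.
\<close>

lemma maximal_ideal_extension:
  assumes J: "set_ideal X J"
  obtains M where "set_ideal X M" "J \<subseteq> M"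
    "\<forall>K. set_ideal X K \<longrightarrow> M \<subseteq> K \<longrightarrow> K = M"
proof -
  let ?E = "{K. set_ideal X K \<and> J \<subseteq> K}"
  have "\<exists>M\<in>?E. \<forall>K\<in>?E. M \<subseteq> K \<longrightarrow> K = M"
  proof (rule subset_Zorn_nonempty)
    show "?E \<noteq> {}" using J by blast
  next
    fix C assume ne: "C \<noteq> {}" and ch: "subset.chain ?E C"
    have el: "set_ideal X K" "J \<subseteq> K" if "K \<in> C" for K
      using ch that by (auto simp: subset_chain_def)
    have "set_ideal X (\<Union>C)"
    proof (rule set_idealI)
      show "{} \<in> \<Union>C" using ne el(1) set_ideal_empty by blast
      show "X \<notin> \<Union>C" using el(1) set_ideal_top by blast
      show "A \<subseteq> X" if "A \<in> \<Union>C" for A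
        using that el(1) set_ideal_carrier by blast
      show "B \<in> \<Union>C" if "A \<in> \<Union>C" "B \<subseteq> A" for A B
        using that el(1) set_ideal_subset by blast
      show "A \<union> B \<in> \<Union>C" if AB: "A \<in> \<Union>C" "B \<in> \<Union>C" for A B
      proof -
        obtain K L where KL: "K \<in> C" "A \<in> K" "L \<in> C" "B \<in> L" using AB by blast
        then have "K \<subseteq> L \<or> L \<subseteq> K" using ch by (auto simp: subset_chain_def)
        then obtain N where "N \<in> C" "A \<in> N" "B \<in> N" using KL by blast
        then show ?thesis using el(1) set_ideal_Un by blast
      qed
    qed
    then show "\<Union>C \<in> ?E" using ne el(2) by blast
  qed
  then obtain M where M: "M \<in> ?E" and max: "\<forall>K\<in>?E. M \<subseteq> K \<longrightarrow> K = M" ..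
  show thesis
  proof (rule that)
    show "set_ideal X M" "J \<subseteq> M" using M by simp_all
    show "\<forall>K. set_ideal X K \<longrightarrow> M \<subseteq> K \<longrightarrow> K = M"
      using max \<open>J \<subseteq> M\<close> by auto
  qed
qed

text \<open>
  If neither \<open>P\<close> nor its complement belonged to a maximal ideal, then adjoining \<open>P\<close> would give a
  larger proper ideal. This is what makes the complements of a maximal ideal an ultrafilter.
\<close>

lemma maximal_ideal_decides:
  assumes M: "set_ideal X M" and max: "\<forall>K. set_ideal X K \<longrightarrow> M \<subseteq> K \<longrightarrow> K = M"
    and P: "P \<subseteq> X"
  shows "P \<in> M \<or> X - P \<in> M"
proof (rule ccontr)
  assume neg: "\<not> (P \<in> M \<or> X - P \<in> M)"
  define K where "K = {Q. Q \<subseteq> X \<and> Q - P \<in> M}"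
  have "set_ideal X K"
  proof (rule set_idealI)
    show "A \<union> B \<in> K" if "A \<in> K" "B \<in> K" for A B
      using that set_ideal_Un[OF M, of "A - P" "B - P"] by (auto simp: K_def Un_Diff)
    show "B \<in> K" if "A \<in> K" "B \<subseteq> A" for A B
      using that set_ideal_subset[OF M, of "A - P" "B - P"] by (auto simp: K_def)
  qed (use neg set_ideal_empty[OF M] in \<open>auto simp: K_def\<close>)
  moreover have "M \<subseteq> K"
  proof
    fix Q assume "Q \<in> M"
    then show "Q \<in> K"
      using set_ideal_carrier[OF M] set_ideal_subset[OF M, of Q "Q - P"] by (auto simp: K_def)
  qed
  ultimately have "K = M" using max by simp
  moreover have "P \<in> K" using P set_ideal_empty[OF M] by (simp add: K_def)
  ultimately show False using neg by blast
qed

text \<open>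
  The ultrafilter consists of the complements of a maximal ideal above
  \<open>{Q. Q \<inter> T \<in> J}\<close>, the ideal generated by \<open>J\<close> and the complement of \<open>T\<close>; it is proper precisely
  because \<open>T \<notin> J\<close>.
\<close>

lemma ultrafilter_avoiding_ideal:
  assumes J: "set_ideal X J" and T: "T \<subseteq> X" "T \<notin> J"
  obtains p where "ultrafilter_on X p" "T \<in> p" "\<And>I. I \<in> J \<Longrightarrow> X - I \<in> p"
proof -
  define K where "K = {Q. Q \<subseteq> X \<and> Q \<inter> T \<in> J}"
  have "set_ideal X K"
  proof (rule set_idealI)
    show "A \<union> B \<in> K" if "A \<in> K" "B \<in> K" for A B
      using that set_ideal_Un[OF J, of "A \<inter> T" "B \<inter> T"] by (auto simp: K_def Int_Un_distrib2)
    show "B \<in> K" if "A \<in> K" "B \<subseteq> A" for A B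
      using that set_ideal_subset[OF J, of "A \<inter> T" "B \<inter> T"] by (auto simp: K_def)
    show "X \<notin> K" using T by (simp add: K_def Int_absorb1)
  qed (use set_ideal_empty[OF J] in \<open>auto simp: K_def\<close>)
  then obtain M where M: "set_ideal X M" "K \<subseteq> M"
    and max: "\<forall>L. set_ideal X L \<longrightarrow> M \<subseteq> L \<longrightarrow> L = M"
    by (rule maximal_ideal_extension)
  define p where "p = {P. P \<subseteq> X \<and> X - P \<in> M}"
  have "ultrafilter_on X p"
    unfolding ultrafilter_on_def
  proof (intro conjI ballI allI impI)
    show "P \<inter> Q \<in> p" if "P \<in> p" "Q \<in> p" for P Q
      using that set_ideal_Un[OF M(1), of "X - P" "X - Q"] by (auto simp: p_def Diff_Int)
    show "Q \<in> p" if "P \<in> p" "P \<subseteq> Q \<and> Q \<subseteq> X" for P Q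
      using that set_ideal_subset[OF M(1), of "X - P" "X - Q"] by (auto simp: p_def)
    show "P \<in> p \<or> X - P \<in> p" if "P \<subseteq> X" for P
      using that maximal_ideal_decides[OF M(1) max that] by (auto simp: p_def double_diff)
  qed (use set_ideal_empty[OF M(1)] set_ideal_top[OF M(1)] in \<open>auto simp: p_def\<close>)
  moreover have "(X - T) \<inter> T = {}" by blast
  then have "X - T \<in> K" using set_ideal_empty[OF J] by (simp add: K_def)
  then have "T \<in> p" using T M(2) by (auto simp: p_def)
  moreover have "X - I \<in> p" if "I \<in> J" for I
  proof -
    have "I \<in> K"
      using that set_ideal_carrier[OF J that] set_ideal_subset[OF J that, of "I \<inter> T"]
      by (auto simp: K_def)
    then show ?thesis using M(2) set_ideal_carrier[OF J that] by (auto simp: p_def double_diff)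
  qed
  ultimately show thesis by (rule that)
qed

lemma ultrafilter_subset: "ultrafilter_on X p \<Longrightarrow> P \<in> p \<Longrightarrow> P \<subseteq> Q \<Longrightarrow> Q \<subseteq> X \<Longrightarrow> Q \<in> p"
  unfolding ultrafilter_on_def by blast

lemma ultrafilter_Int: "ultrafilter_on X p \<Longrightarrow> P \<in> p \<Longrightarrow> Q \<in> p \<Longrightarrow> P \<inter> Q \<in> p"
  unfolding ultrafilter_on_def by blast

lemma ultrafilter_empty: "ultrafilter_on X p \<Longrightarrow> {} \<notin> p"
  unfolding ultrafilter_on_def by blast

section \<open>Translates of ideals and ultrafilters\<close>

context group_action
begin

lemma preimage_eq_image_inv:
  assumes "g \<in> carrier G" "B \<subseteq> E"
  shows "{x \<in> E. \<phi> g x \<in> B} = \<phi> (inv g) ` B"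
proof -
  interpret group G using group_hom group_hom.axioms(1) by auto
  have gi: "inv g \<in> carrier G" using assms(1) by simp
  show ?thesis
  proof (intro equalityI subsetI)
    fix x assume "x \<in> {x \<in> E. \<phi> g x \<in> B}"
    then show "x \<in> \<phi> (inv g) ` B"
      using orbit_sym_aux[OF assms(1), of x] by (metis (mono_tags, lifting) imageI mem_Collect_eq)
  next
    fix x assume "x \<in> \<phi> (inv g) ` B"
    then obtain b where b: "b \<in> B" "\<phi> (inv g) b = x" by blast
    have "b \<in> E" using b(1) assms(2) by blast
    moreover have "\<phi> (inv (inv g)) x = b"
      using orbit_sym_aux[OF gi] b(2) \<open>b \<in> E\<close> by blast
    then have "\<phi> g x = b" using assms(1) by simp
    ultimately show "x \<in> {x \<in> E. \<phi> g x \<in> B}"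
      using element_image[OF gi] b by blast
  qed
qed

lemma translation_invariant_preimage:
  assumes J: "set_ideal E J" "translation_invariant G \<phi> J" and g: "g \<in> carrier G" and I: "I \<in> J"
  shows "{x \<in> E. \<phi> g x \<in> I} \<in> J"
proof -
  interpret group G using group_hom group_hom.axioms(1) by auto
  show ?thesis
    using preimage_eq_image_inv[OF g set_ideal_carrier[OF J(1) I]] J(2) g I
    by (simp add: translation_invariant_def)
qed

lemma in_translate_ultrafilter_iff:
  assumes p: "p \<subseteq> Pow E" and g: "g \<in> carrier G"
  shows "P \<in> translate_ultrafilter \<phi> g p \<longleftrightarrow> P \<subseteq> E \<and> {x \<in> E. \<phi> g x \<in> P} \<in> p"
proof
  assume "P \<in> translate_ultrafilter \<phi> g p"
  then obtain Q where Q: "Q \<in> p" "P = \<phi> g ` Q" by (auto simp: translate_ultrafilter_def)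
  then have "Q \<subseteq> E" using p by blast
  then have "{x \<in> E. \<phi> g x \<in> P} = Q"
    using Q(2) inj_prop[OF g] by (auto dest: inj_onD)
  then show "P \<subseteq> E \<and> {x \<in> E. \<phi> g x \<in> P} \<in> p"
    using Q \<open>Q \<subseteq> E\<close> element_image[OF g] by auto
next
  assume P: "P \<subseteq> E \<and> {x \<in> E. \<phi> g x \<in> P} \<in> p"
  have "P = \<phi> g ` {x \<in> E. \<phi> g x \<in> P}"
  proof (intro equalityI subsetI)
    fix y assume "y \<in> P"
    then have "y \<in> \<phi> g ` E" using P surj_prop[OF g] by auto
    then show "y \<in> \<phi> g ` {x \<in> E. \<phi> g x \<in> P}" using \<open>y \<in> P\<close> by auto
  qed auto
  then show "P \<in> translate_ultrafilter \<phi> g p"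
    using P by (auto simp: translate_ultrafilter_def)
qed

text \<open>
  Where \<open>g\<close> and \<open>h\<close> agree, the preimages of a set under them have the same points, and \<open>p\<close> does
  not see the rest.
\<close>

lemma translate_ultrafilter_eqI:
  assumes p: "ultrafilter_on E p" and gh: "g \<in> carrier G" "h \<in> carrier G"
    and agree: "{x \<in> E. \<phi> g x = \<phi> h x} \<in> p"
  shows "translate_ultrafilter \<phi> g p = translate_ultrafilter \<phi> h p"
proof -
  have p': "p \<subseteq> Pow E" using p by (simp add: ultrafilter_on_def)
  have "translate_ultrafilter \<phi> u p \<subseteq> translate_ultrafilter \<phi> v p"
    if uv: "u \<in> carrier G" "v \<in> carrier G" "{x \<in> E. \<phi> u x = \<phi> v x} \<in> p" for u v
  proof
    fix P assume "P \<in> translate_ultrafilter \<phi> u p"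
    then have P: "P \<subseteq> E" "{x \<in> E. \<phi> u x \<in> P} \<in> p"
      using in_translate_ultrafilter_iff[OF p' uv(1)] by auto
    have "{x \<in> E. \<phi> v x \<in> P} \<in> p"
      by (rule ultrafilter_subset[OF p ultrafilter_Int[OF p P(2) uv(3)]]) auto
    then show "P \<in> translate_ultrafilter \<phi> v p"
      using P(1) in_translate_ultrafilter_iff[OF p' uv(2)] by blast
  qed
  moreover have "{x \<in> E. \<phi> h x = \<phi> g x} \<in> p" using agree by (simp add: eq_commute)
  ultimately show ?thesis using gh agree by blast
qed

text \<open>
  Take \<open>T\<close> maximal among the subsets of \<open>S\<close> whose images under \<open>f\<close> and \<open>g\<close> are disjoint. A point
  \<open>x\<close> of \<open>S\<close> outside \<open>T\<close> cannot be added, and \<open>f x \<noteq> g x\<close>, so \<open>f x \<in> g T\<close> or \<open>g x \<in> f T\<close>. Thus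
  \<open>S\<close> is covered by \<open>T\<close>, \<open>f\<^sup>-\<^sup>1 g T\<close> and \<open>g\<^sup>-\<^sup>1 f T\<close>, and invariance of \<open>J\<close> would carry
  \<open>T \<in> J\<close> over to \<open>S\<close>.
\<close>

lemma separated_subset_notin_ideal:
  assumes J: "set_ideal E J" "translation_invariant G \<phi> J"
    and f: "f \<in> carrier G" and g: "g \<in> carrier G"
    and S: "S \<subseteq> E" "S \<notin> J" and moved: "\<And>x. x \<in> S \<Longrightarrow> \<phi> f x \<noteq> \<phi> g x"
  obtains T where "T \<subseteq> S" "T \<notin> J" "\<phi> f ` T \<inter> \<phi> g ` T = {}"
proof -
  let ?D = "{T. T \<subseteq> S \<and> \<phi> f ` T \<inter> \<phi> g ` T = {}}"
  have "\<exists>T\<in>?D. \<forall>U\<in>?D. T \<subseteq> U \<longrightarrow> U = T"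
  proof (rule subset_Zorn_nonempty)
    show "?D \<noteq> {}" by blast
  next
    fix C assume ch: "subset.chain ?D C"
    have "\<phi> f x \<noteq> \<phi> g y" if "x \<in> \<Union>C" "y \<in> \<Union>C" for x y
    proof -
      obtain U V where UV: "U \<in> C" "x \<in> U" "V \<in> C" "y \<in> V" using \<open>x \<in> \<Union>C\<close> \<open>y \<in> \<Union>C\<close> by blast
      then have "U \<subseteq> V \<or> V \<subseteq> U" using ch by (auto simp: subset_chain_def)
      then obtain W where "W \<in> C" "x \<in> W" "y \<in> W" using UV by blast
      moreover have "\<phi> f ` W \<inter> \<phi> g ` W = {}" using ch \<open>W \<in> C\<close> by (auto simp: subset_chain_def)
      ultimately show ?thesis by blast
    qed
    then show "\<Union>C \<in> ?D" using ch by (auto simp: subset_chain_def)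
  qed
  then obtain T where TD: "T \<in> ?D" and maxD: "\<forall>U\<in>?D. T \<subseteq> U \<longrightarrow> U = T" ..
  have T: "T \<subseteq> S" "\<phi> f ` T \<inter> \<phi> g ` T = {}" using TD by simp_all
  have max: "U = T" if "U \<subseteq> S" "\<phi> f ` U \<inter> \<phi> g ` U = {}" "T \<subseteq> U" for U
    using maxD that by simp
  have cover: "S \<subseteq> T \<union> {x \<in> E. \<phi> f x \<in> \<phi> g ` T} \<union> {x \<in> E. \<phi> g x \<in> \<phi> f ` T}"
  proof
    fix x assume x: "x \<in> S"
    show "x \<in> T \<union> {x \<in> E. \<phi> f x \<in> \<phi> g ` T} \<union> {x \<in> E. \<phi> g x \<in> \<phi> f ` T}"
    proof (rule ccontr)
      assume neg: "\<not> ?thesis"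
      then have "\<phi> f ` insert x T \<inter> \<phi> g ` insert x T = {}"
        using T(2) S(1) x moved[OF x] by auto
      then have "insert x T = T" using max[of "insert x T"] x T(1) by blast
      then show False using neg by blast
    qed
  qed
  have "T \<notin> J"
  proof
    assume "T \<in> J"
    then have "\<phi> f ` T \<in> J" "\<phi> g ` T \<in> J"
      using J(2) f g by (auto simp: translation_invariant_def)
    then have "T \<union> {x \<in> E. \<phi> f x \<in> \<phi> g ` T} \<union> {x \<in> E. \<phi> g x \<in> \<phi> f ` T} \<in> J"
      using \<open>T \<in> J\<close> f g by (intro set_ideal_Un[OF J(1)] translation_invariant_preimage[OF J])
    then show False using set_ideal_subset[OF J(1) _ cover] S(2) by blast
  qed
  then show thesis using that[of T] T by simp
qed

section \<open>Thin sets and companions\<close>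

lemma thin_companion_unique:
  assumes J: "set_ideal E J" "translation_invariant G \<phi> J"
    and thin: "thin G \<phi> J A" and p: "p \<in> ideal_check E J"
    and q: "q \<in> companion G \<phi> p A" and r: "r \<in> companion G \<phi> p A"
  shows "q = r"
proof -
  interpret group G using group_hom group_hom.axioms(1) by auto
  have up: "ultrafilter_on E p" and avoid: "\<And>I. I \<in> J \<Longrightarrow> E - I \<in> p"
    using p by (auto simp: ideal_check_def stone_cech_remainder_def stone_cech_def)
  then have p': "p \<subseteq> Pow E" by (simp add: ultrafilter_on_def)
  obtain g where g: "g \<in> carrier G" "q = translate_ultrafilter \<phi> g p" "A \<in> q"
    using q by (auto simp: companion_def)
  obtain h where h: "h \<in> carrier G" "r = translate_ultrafilter \<phi> h p" "A \<in> r"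
    using r by (auto simp: companion_def)
  let ?F = "{\<one>, h \<otimes> inv g}"
  have "finite ?F \<and> ?F \<subseteq> carrier G" using g h by simp
  then obtain I where I: "I \<in> J" "\<And>a. a \<in> A - I \<Longrightarrow> card ((\<lambda>u. \<phi> u a) ` ?F \<inter> A) \<le> 1"
    using thin unfolding thin_def by meson
  let ?B = "({x \<in> E. \<phi> g x \<in> A} \<inter> {x \<in> E. \<phi> h x \<in> A}) \<inter> (E - {x \<in> E. \<phi> g x \<in> I})"
  have B: "?B \<in> p"
    using g h in_translate_ultrafilter_iff[OF p']
    by (intro ultrafilter_Int[OF up] avoid translation_invariant_preimage[OF J] I) auto
  have agree: "\<phi> g x = \<phi> h x" if x: "x \<in> ?B" for x
  proof -
    have xE: "x \<in> E" and a: "\<phi> g x \<in> A - I" and b: "\<phi> h x \<in> A" using x by auto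
    have gE: "\<phi> g x \<in> E" using element_image[OF g(1) xE] by simp
    have one: "\<phi> \<one> (\<phi> g x) = \<phi> g x" using id_eq_one gE by (metis restrict_apply')
    have "\<phi> (h \<otimes> inv g) (\<phi> g x) = \<phi> h (\<phi> (inv g) (\<phi> g x))"
      using composition_rule[OF gE] g(1) h(1) by simp
    also have "\<phi> (inv g) (\<phi> g x) = x" using orbit_sym_aux[OF g(1) xE] by simp
    finally have "(\<lambda>u. \<phi> u (\<phi> g x)) ` ?F \<inter> A = {\<phi> g x, \<phi> h x}" using one a b by auto
    then have "card {\<phi> g x, \<phi> h x} \<le> 1" using I(2)[OF a] by simp
    then show ?thesis by (auto simp: card_insert_if split: if_splits)
  qed
  have "{x \<in> E. \<phi> g x = \<phi> h x} \<in> p"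
    by (rule ultrafilter_subset[OF up B]) (use agree in auto)
  then show ?thesis using translate_ultrafilter_eqI[OF up] g h by simp
qed

text \<open>
  The union of the sets \<open>{x. f x \<in> A, g x \<in> A, f x \<noteq> g x}\<close> over \<open>f, g \<in> F\<close> contains every
  point of \<open>A\<close> at which the thinness condition for \<open>F\<close> breaks, so if all of them were in \<open>J\<close>, it would be
  a legitimate exceptional set.
\<close>

lemma not_thin_obtains:
  assumes J: "set_ideal E J" and A: "A \<subseteq> E" and nt: "\<not> thin G \<phi> J A"
  obtains f g where "f \<in> carrier G" "g \<in> carrier G"
    "{x \<in> E. \<phi> f x \<in> A \<and> \<phi> g x \<in> A \<and> \<phi> f x \<noteq> \<phi> g x} \<notin> J"
proof -
  define S where "S = (\<lambda>(f, g). {x \<in> E. \<phi> f x \<in> A \<and> \<phi> g x \<in> A \<and> \<phi> f x \<noteq> \<phi> g x})"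
  obtain F where F: "finite F" "F \<subseteq> carrier G"
    and nI: "\<not> (\<exists>I\<in>J. \<forall>a\<in>A - I. card ((\<lambda>u. \<phi> u a) ` F \<inter> A) \<le> 1)"
    using nt unfolding thin_def by auto
  have "\<exists>k\<in>F \<times> F. S k \<notin> J"
  proof (rule ccontr)
    assume "\<not> ?thesis"
    then have "(\<Union>k\<in>F \<times> F. S k) \<in> J" using F(1) by (intro set_ideal_UN[OF J]) auto
    then obtain a where a: "a \<in> A" "a \<notin> (\<Union>k\<in>F \<times> F. S k)"
      and card: "\<not> card ((\<lambda>u. \<phi> u a) ` F \<inter> A) \<le> 1"
      using nI by auto
    have "y = z" if yz: "y \<in> (\<lambda>u. \<phi> u a) ` F \<inter> A" "z \<in> (\<lambda>u. \<phi> u a) ` F \<inter> A" for y z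
    proof (rule ccontr)
      assume "y \<noteq> z"
      obtain f g where fg: "f \<in> F" "y = \<phi> f a" "g \<in> F" "z = \<phi> g a" using yz by blast
      then have "a \<in> S (f, g)" using yz a(1) A \<open>y \<noteq> z\<close> by (auto simp: S_def)
      then show False using a(2) fg(1,3) by blast
    qed
    then show False using card F(1) by (auto simp: card_le_Suc0_iff_eq)
  qed
  then obtain f g where "f \<in> F" "g \<in> F" "S (f, g) \<notin> J" by blast
  then show thesis using that[of f g] F(2) by (auto simp: S_def)
qed

end

text \<open>
  Some point lies in a member of \<open>J\<close>, and transitivity moves it everywhere.
\<close>

lemma (in transitive_action) translation_invariant_ideal_singleton:
  assumes J: "set_ideal E J" "J \<noteq> {{}}" "translation_invariant G \<phi> J" and y: "y \<in> E"
  shows "{y} \<in> J"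
proof -
  obtain I x where I: "I \<in> J" "x \<in> I" using J(2) set_ideal_empty[OF J(1)] by blast
  have x: "{x} \<in> J" using set_ideal_subset[OF J(1) I(1)] I(2) by blast
  have "x \<in> E" using set_ideal_carrier[OF J(1) I(1)] I(2) by blast
  then obtain g where "g \<in> carrier G" "\<phi> g x = y" using unique_orbit y by blast
  then show ?thesis using J(3) x unfolding translation_invariant_def by force
qed

lemma (in transitive_action) ideal_check_containing:
  assumes J: "set_ideal E J" "J \<noteq> {{}}" "translation_invariant G \<phi> J"
    and T: "T \<subseteq> E" "T \<notin> J"
  obtains p where "p \<in> ideal_check E J" "T \<in> p"
proof -
  obtain p where p: "ultrafilter_on E p" "T \<in> p" "\<And>I. I \<in> J \<Longrightarrow> E - I \<in> p"
    by (rule ultrafilter_avoiding_ideal[OF J(1) T]) blast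
  have "p \<noteq> principal_ultrafilter E x" if "x \<in> E" for x
    using p(3)[OF translation_invariant_ideal_singleton[OF J that]]
    by (auto simp: principal_ultrafilter_def)
  then have "p \<in> ideal_check E J"
    using p by (auto simp: ideal_check_def stone_cech_remainder_def stone_cech_def)
  then show thesis using p(2) by (rule that)
qed

lemma (in transitive_action) not_thin_companion_not_unique:
  assumes J: "set_ideal E J" "J \<noteq> {{}}" "translation_invariant G \<phi> J"
    and A: "A \<subseteq> E" and nt: "\<not> thin G \<phi> J A"
  obtains p q r where "p \<in> ideal_check E J" "q \<in> companion G \<phi> p A" "r \<in> companion G \<phi> p A" "q \<noteq> r"
proof -
  obtain f g where f: "f \<in> carrier G" and g: "g \<in> carrier G"
    and S: "{x \<in> E. \<phi> f x \<in> A \<and> \<phi> g x \<in> A \<and> \<phi> f x \<noteq> \<phi> g x} \<notin> J"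
    by (rule not_thin_obtains[OF J(1) A nt])
  then obtain T where T: "T \<subseteq> {x \<in> E. \<phi> f x \<in> A \<and> \<phi> g x \<in> A \<and> \<phi> f x \<noteq> \<phi> g x}"
    "T \<notin> J" "\<phi> f ` T \<inter> \<phi> g ` T = {}"
    using separated_subset_notin_ideal[OF J(1,3) f g _ S] by blast
  then have "T \<subseteq> E" by blast
  then obtain p where p: "p \<in> ideal_check E J" "T \<in> p"
    using ideal_check_containing[OF J _ T(2)] by blast
  then have up: "ultrafilter_on E p"
    by (auto simp: ideal_check_def stone_cech_remainder_def stone_cech_def)
  then have p': "p \<subseteq> Pow E" by (simp add: ultrafilter_on_def)
  have comp: "translate_ultrafilter \<phi> u p \<in> companion G \<phi> p A"
    if "u \<in> carrier G" "\<And>x. x \<in> T \<Longrightarrow> \<phi> u x \<in> A" for u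
  proof -
    have "{x \<in> E. \<phi> u x \<in> A} \<in> p"
      by (rule ultrafilter_subset[OF up p(2)]) (use that(2) \<open>T \<subseteq> E\<close> in auto)
    then show ?thesis
      using in_translate_ultrafilter_iff[OF p' that(1)] A that(1) by (auto simp: companion_def)
  qed
  have "translate_ultrafilter \<phi> f p \<noteq> translate_ultrafilter \<phi> g p"
  proof
    assume eq: "translate_ultrafilter \<phi> f p = translate_ultrafilter \<phi> g p"
    have "\<phi> f ` T \<in> translate_ultrafilter \<phi> f p"
      using p(2) by (auto simp: translate_ultrafilter_def)
    then have "{x \<in> E. \<phi> g x \<in> \<phi> f ` T} \<in> p"
      using eq in_translate_ultrafilter_iff[OF p' g] by blast
    from ultrafilter_Int[OF up this p(2)] have "{} \<in> p"
    proof (rule back_subst[of "\<lambda>Q. Q \<in> p"])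
      show "{x \<in> E. \<phi> g x \<in> \<phi> f ` T} \<inter> T = {}" using T(3) by blast
    qed
    then show False using ultrafilter_empty[OF up] by blast
  qed
  moreover have "translate_ultrafilter \<phi> f p \<in> companion G \<phi> p A"
    using comp[OF f] T(1) by blast
  moreover have "translate_ultrafilter \<phi> g p \<in> companion G \<phi> p A"
    using comp[OF g] T(1) by blast
  ultimately show thesis by (rule that[OF p(1), rotated 2])
qed

theorem theorem3p2:
  fixes G :: "('g, 'm) monoid_scheme"
    and X :: "'x set"
    and \<phi> :: "'g \<Rightarrow> 'x \<Rightarrow> 'x"
    and J :: "'x set set"
    and A :: "'x set"
  assumes "transitive_action G X \<phi>"
    and "infinite X"
    and "set_ideal X J"
    and "J \<noteq> {{}}"
    and "translation_invariant G \<phi> J"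
    and "A \<subseteq> X"
  shows "thin G \<phi> J A \<longleftrightarrow>
    (\<forall>p\<in>ideal_check X J. finite (companion G \<phi> p A) \<and> card (companion G \<phi> p A) \<le> 1)"
proof -
  interpret transitive_action G X \<phi> by (rule assms(1))
  show ?thesis
  proof
    assume thin: "thin G \<phi> J A"
    show "\<forall>p\<in>ideal_check X J. finite (companion G \<phi> p A) \<and> card (companion G \<phi> p A) \<le> 1"
    proof
      fix p assume p: "p \<in> ideal_check X J"
      have "q = r" if "q \<in> companion G \<phi> p A" "r \<in> companion G \<phi> p A" for q r
        using thin_companion_unique[OF assms(3,5) thin p that] .
      then have "companion G \<phi> p A = {} \<or> (\<exists>q. companion G \<phi> p A = {q})" by blast
      then show "finite (companion G \<phi> p A) \<and> card (companion G \<phi> p A) \<le> 1" by auto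
    qed
  next
    assume small: "\<forall>p\<in>ideal_check X J. finite (companion G \<phi> p A) \<and> card (companion G \<phi> p A) \<le> 1"
    show "thin G \<phi> J A"
    proof (rule ccontr)
      assume "\<not> thin G \<phi> J A"
      then obtain p q r where p: "p \<in> ideal_check X J"
        and qr: "q \<in> companion G \<phi> p A" "r \<in> companion G \<phi> p A" "q \<noteq> r"
        using not_thin_companion_not_unique[OF assms(3-6)] by blast
      have "finite (companion G \<phi> p A)" "card (companion G \<phi> p A) \<le> Suc 0"
        using small p by auto
      then show False using qr card_le_Suc0_iff_eq by blast
    qed
  qed
qed

end
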